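(* Let $\rho=\mathbf 1_{[0,1]}$ be the uniform density on $[0,1]$, and for $k\in\mathbb N=\{1,2,\dots\}$ let $\sigma_k=2\cdot\mathbf 1_{H_k}$, where $H_k=\bigcup_{j=0}^{2^{k-1}-1}\left[\frac{j}{2^{k-1}},\frac{j}{2^{k-1}}+\frac1{2^k}\right]$. Let $S=\{\sigma_k:k\in\mathbb N\}$. Then $\mathrm e(\rho\|S)=0$ for each of the exponents $\mathrm e=\mathrm s$ (Stein), $\mathrm e=\mathrm c$ (Chernoff), and $\mathrm e=\mathrm d_r$ (direct), $r>0$.
   Context: For a probability density $\omega$ on $[0,1]$ (w.r.t. Lebesgue measure $\lambda$), $\omega^{\otimes n}$ is the product density on $[0,1]^n$. A test on $n$ samples is a measurable function $T_n:[0,1]^n\to[0,1]$, and $\omega^{\otimes n}(T_n)=\int_{[0,1]^n}\omega^{\otimes n}T_n\,d\lambda$. The error probabilities are $\alpha_n(T_n)=\rho^{\otimes n}(1-T_n)$ and $\beta_n(T_n)=\sup_{k\in\mathbb N}\sigma_k^{\otimes n}(T_n)$. With $\log$ natural and $-\log0=+\infty$: the Stein exponent $\mathrm s(\rho\|S)$ is the supremum of $\liminf_n-\frac1n\log\beta_n(T_n)$ over test sequences with $\lim_n\alpha_n(T_n)=0$; the direct exponent $\mathrm d_r(\rho\|S)$ is the supremum of $\liminf_n-\frac1n\log\alpha_n(T_n)$ over test sequences with $\liminf_n-\frac1n\log\beta_n(T_n)\ge r$; the Chernoff exponent $\mathrm c(\rho\|S)$ is the supremum of all $r\ge0$ for which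 some test sequence satisfies both $\liminf_n-\frac1n\log\alpha_n(T_n)\ge r$ and $\liminf_n-\frac1n\log\beta_n(T_n)\ge r$. *)

theory Defs
  imports "HOL-Analysis.Analysis"
begin

text \<open>Densities are real functions of which only the values on \<open>[0,1]\<close> matter.  A point of
  \<open>[0,1]\<^sup>n\<close> is a function \<open>nat \<Rightarrow> real\<close> with coordinates indexed by \<open>{..<n}\<close>
  and value \<open>undefined\<close> elsewhere, as usual for \<open>PiM\<close>; measurability is Borel measurability.\<close>

definition unit_interval :: "real measure" where
  "unit_interval = restrict_space lborel {0..1}"

definition unit_cube :: "nat \<Rightarrow> (nat \<Rightarrow> real) measure" where
  "unit_cube n = PiM {..<n} (\<lambda>_. unit_interval)"

definition is_test :: "nat \<Rightarrow> ((nat \<Rightarrow> real) \<Rightarrow> real) \<Rightarrow> bool" where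
  "is_test n T \<longleftrightarrow>
     T \<in> borel_measurable (unit_cube n) \<and> (\<forall>x\<in>space (unit_cube n). 0 \<le> T x \<and> T x \<le> 1)"

definition test_sequence :: "(nat \<Rightarrow> (nat \<Rightarrow> real) \<Rightarrow> real) \<Rightarrow> bool" where
  "test_sequence T \<longleftrightarrow> (\<forall>n\<ge>1. is_test n (T n))"

definition tensor_density :: "(real \<Rightarrow> real) \<Rightarrow> nat \<Rightarrow> (nat \<Rightarrow> real) \<Rightarrow> real" where
  "tensor_density \<omega> n x = (\<Prod>i<n. \<omega> (x i))"

definition expect_test :: "(real \<Rightarrow> real) \<Rightarrow> nat \<Rightarrow> ((nat \<Rightarrow> real) \<Rightarrow> real) \<Rightarrow> real" where
  "expect_test \<omega> n T = (\<integral>x. tensor_density \<omega> n x * T x \<partial>unit_cube n)"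

definition type1_error :: "(real \<Rightarrow> real) \<Rightarrow> nat \<Rightarrow> ((nat \<Rightarrow> real) \<Rightarrow> real) \<Rightarrow> real" where
  "type1_error \<rho> n T = expect_test \<rho> n (\<lambda>x. 1 - T x)"

text \<open>For a nonempty set \<open>S\<close> of probability densities and a test \<open>T\<close>, the real supremum is over a
  nonempty subset of \<open>[0,1]\<close>.\<close>

definition type2_error :: "(real \<Rightarrow> real) set \<Rightarrow> nat \<Rightarrow> ((nat \<Rightarrow> real) \<Rightarrow> real) \<Rightarrow> real" where
  "type2_error S n T = (SUP \<sigma>\<in>S. expect_test \<sigma> n T)"

text \<open>Only used for arguments \<open>\<ge> 0\<close>; the library convention \<open>ln 0 = 0\<close> has to be overridden.\<close>

definition neg_log :: "real \<Rightarrow> ereal" where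
  "neg_log x = (if x = 0 then \<infinity> else ereal (- ln x))"

definition error_rate :: "(nat \<Rightarrow> real) \<Rightarrow> ereal" where
  "error_rate e = liminf (\<lambda>n. ereal (1 / real n) * neg_log (e n))"

definition stein_exponent :: "(real \<Rightarrow> real) \<Rightarrow> (real \<Rightarrow> real) set \<Rightarrow> ereal" where
  "stein_exponent \<rho> S =
     Sup {error_rate (\<lambda>n. type2_error S n (T n)) | T.
            test_sequence T \<and> (\<lambda>n. type1_error \<rho> n (T n)) \<longlonglongrightarrow> 0}"

definition direct_exponent :: "real \<Rightarrow> (real \<Rightarrow> real) \<Rightarrow> (real \<Rightarrow> real) set \<Rightarrow> ereal" where
  "direct_exponent r \<rho> S =
     Sup {error_rate (\<lambda>n. type1_error \<rho> n (T n)) | T.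
            test_sequence T \<and> error_rate (\<lambda>n. type2_error S n (T n)) \<ge> ereal r}"

definition chernoff_exponent :: "(real \<Rightarrow> real) \<Rightarrow> (real \<Rightarrow> real) set \<Rightarrow> ereal" where
  "chernoff_exponent \<rho> S =
     Sup {ereal r | r. r \<ge> 0 \<and>
            (\<exists>T. test_sequence T \<and>
                 error_rate (\<lambda>n. type1_error \<rho> n (T n)) \<ge> ereal r \<and>
                 error_rate (\<lambda>n. type2_error S n (T n)) \<ge> ereal r)}"

definition uniform_density :: "real \<Rightarrow> real" where
  "uniform_density = indicator {0..1}"

definition H_set :: "nat \<Rightarrow> real set" where
  "H_set k = (\<Union>j\<in>{0..<2 ^ (k - 1)}.
            {real j / 2 ^ (k - 1) .. real j / 2 ^ (k - 1) + 1 / 2 ^ k})"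

definition sigma_density :: "nat \<Rightarrow> real \<Rightarrow> real" where
  "sigma_density k x = 2 * indicator (H_set k) x"

definition sigma_family :: "(real \<Rightarrow> real) set" where
  "sigma_family = {sigma_density k | k. k \<ge> 1}"

end

theory Submission
  imports Defs "HOL-Probability.Infinite_Product_Measure"
begin

text \<open>Up to a null set, \<open>\<sigma>\<^sub>k = 1 + r\<^sub>k\<close> on \<open>[0,1]\<close> with the Rademacher functions \<open>r\<^sub>k\<close>. Hence, for fixed
  \<open>n\<close>, the functions \<open>\<sigma>\<^sub>k\<^sup>\<otimes>\<^sup>n - 1\<close> are pairwise orthogonal of constant \<open>L\<^sup>2\<close> norm on the cube, so no
  test can have correlation \<open>\<le> -\<epsilon> < 0\<close> with all of them.
  Consequently \<open>\<alpha>\<^sub>n(T) + \<beta>\<^sub>n(T) \<ge> 1\<close> for every test, and the two errors cannot both tend to zero.\<close>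

section \<open>Orthogonal systems in a probability space\<close>

text \<open>This is Bessel's inequality in disguise: correlations with an orthogonal system of
  constant norm are square summable, so they cannot stay away from 0. Expanding the square of
  \<open>c * T\<close> plus \<open>K\<close> of the functions bounds \<open>K\<close>.\<close>

lemma (in prob_space) orthogonal_correlation_lower_bound:
  fixes h :: "nat \<Rightarrow> 'a \<Rightarrow> real" and T :: "'a \<Rightarrow> real"
  assumes h_meas [measurable]: "\<And>k. h k \<in> borel_measurable M"
    and h_bdd: "\<And>k x. x \<in> space M \<Longrightarrow> \<bar>h k x\<bar> \<le> B"
    and orth: "\<And>k l. k \<noteq> l \<Longrightarrow> (\<integral>x. h k x * h l x \<partial>M) = 0"
    and sq: "\<And>k. (\<integral>x. h k x * h k x \<partial>M) = D"
    and T_meas [measurable]: "T \<in> borel_measurable M"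
    and T_bdd: "\<And>x. x \<in> space M \<Longrightarrow> \<bar>T x\<bar> \<le> 1"
    and "\<epsilon> > 0"
  shows "\<exists>k. (\<integral>x. h k x * T x \<partial>M) > - \<epsilon>"
proof (rule ccontr)
  assume "\<not> ?thesis"
  then have neg: "(\<integral>x. h k x * T x \<partial>M) \<le> - \<epsilon>" for k
    by (meson not_le)
  have int_hh [simp]: "integrable M (\<lambda>x. h k x * h l x)" for k l
    by (rule integrable_const_bound[of _ "B * B"])
       (auto simp: abs_mult intro!: mult_mono h_bdd order_trans[OF abs_ge_zero h_bdd])
  have int_hT [simp]: "integrable M (\<lambda>x. h k x * T x)" for k
    by (rule integrable_const_bound[of _ "B * 1"])
       (auto simp: abs_mult simp del: mult_1_right
             intro!: mult_mono h_bdd T_bdd order_trans[OF abs_ge_zero h_bdd])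
  have TT_le: "T x * T x \<le> 1" if "x \<in> space M" for x
    using T_bdd[OF that] by (simp add: abs_square_le_1 flip: power2_eq_square)
  have int_TT [simp]: "integrable M (\<lambda>x. T x * T x)"
    by (rule integrable_const_bound[of _ 1])
       (auto intro!: AE_I2 TT_le)
  have TT: "(\<integral>x. T x * T x \<partial>M) \<le> 1"
  proof -
    have "(\<integral>x. T x * T x \<partial>M) \<le> (\<integral>x. 1 \<partial>M)"
      by (intro integral_mono) (simp_all add: TT_le)
    then show ?thesis by (simp add: prob_space)
  qed
  have bound: "real K * \<epsilon>\<^sup>2 \<le> D" if "K > 0" for K
  proof -
    \<comment> \<open>minimises the estimate for \<open>\<integral>(c T + \<Sum>h\<^sub>k)\<^sup>2\<close> below\<close>
    define c where "c = real K * \<epsilon>"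
    have "0 \<le> (\<integral>x. (c * T x + (\<Sum>k<K. h k x))\<^sup>2 \<partial>M)"
      by simp
    also have "\<dots> = (\<integral>x. c\<^sup>2 * (T x * T x) + 2 * c * (\<Sum>k<K. h k x * T x)
                        + (\<Sum>k<K. \<Sum>l<K. h k x * h l x) \<partial>M)"
      by (intro Bochner_Integration.integral_cong refl)
         (simp add: power2_eq_square algebra_simps sum_product sum_distrib_left)
    also have "\<dots> = c\<^sup>2 * (\<integral>x. T x * T x \<partial>M) + 2 * c * (\<Sum>k<K. \<integral>x. h k x * T x \<partial>M)
                        + (\<Sum>k<K. \<Sum>l<K. \<integral>x. h k x * h l x \<partial>M)"
      by simp
    also have "(\<Sum>k<K. \<Sum>l<K. \<integral>x. h k x * h l x \<partial>M) = (\<Sum>k<K. \<Sum>l<K. if k = l then D else 0)"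
      by (intro sum.cong refl) (simp add: orth sq)
    also have "\<dots> = real K * D"
      by simp
    also have "c\<^sup>2 * (\<integral>x. T x * T x \<partial>M) \<le> c\<^sup>2 * 1"
      by (intro mult_left_mono TT) auto
    also have "2 * c * (\<Sum>k<K. \<integral>x. h k x * T x \<partial>M) \<le> 2 * c * (\<Sum>k<K. - \<epsilon>)"
      using \<open>\<epsilon> > 0\<close> by (intro mult_left_mono sum_mono neg) (auto simp: c_def)
    \<comment> \<open>With \<open>c = K * \<epsilon>\<close> the upper bound
      \<open>c\<^sup>2 - 2 * c * K * \<epsilon> + K * D\<close> collapses to this product.\<close>
    finally have "0 \<le> real K * (D - real K * \<epsilon>\<^sup>2)"
      by (simp add: c_def power2_eq_square algebra_simps)
    with that show ?thesis
      by (simp add: zero_le_mult_iff)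
  qed
  obtain K :: nat where "D / \<epsilon>\<^sup>2 < real K"
    using reals_Archimedean2 by blast
  \<comment> \<open>The successor is taken because \<open>bound\<close> asks for a positive number
    of functions.\<close>
  then have "D < real (Suc K) * \<epsilon>\<^sup>2"
    using \<open>\<epsilon> > 0\<close> by (simp add: divide_less_eq algebra_simps add_strict_increasing2)
  with bound[of "Suc K"] show False by simp
qed

section \<open>Exponential rates and the threshold 1/2\<close>

text \<open>An error of at least 1/2 contributes at most \<open>ln 2 / n\<close> to the rate, which
  falls below any positive constant. The threshold 1/2 is chosen because two errors below it have a
  sum below 1.\<close>

lemma eventually_less_half_of_error_rate_pos:
  assumes "error_rate e > 0"
  shows "\<forall>\<^sub>F n in sequentially. e n < 1 / 2"
proof -
  obtain c :: real where c: "0 < ereal c" "ereal c < error_rate e"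
    using ereal_dense2[OF assms] by blast
  have "\<forall>\<^sub>F n in sequentially. ereal c < ereal (1 / real n) * neg_log (e n)"
    using c(2) unfolding error_rate_def by (rule less_LiminfD)
  moreover have "\<forall>\<^sub>F n in sequentially. real n > ln 2 / c"
    by (rule eventually_compose_filterlim[OF eventually_gt_at_top filterlim_real_sequentially])
  ultimately show ?thesis
    using eventually_gt_at_top[of 0]
  proof eventually_elim
    case (elim n)
    show ?case
    proof (rule ccontr)
      assume "\<not> e n < 1 / 2"
      then have e: "e n \<ge> 1 / 2" by simp
      then have "ln (1 / 2) \<le> ln (e n)"
        by (subst ln_le_cancel_iff) auto
      then have "- ln (e n) \<le> ln 2"
        by (simp add: ln_div)
      also have "ln 2 < c * real n"
        using elim(2) c(1) by (simp add: divide_less_eq mult.commute)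
      finally have "1 / real n * - ln (e n) < c"
        using elim(3) by (simp add: field_simps)
      \<comment> \<open>Since \<open>e n \<ge> 1 / 2\<close>, the infinite value of
        \<open>neg_log\<close> at 0 does not occur.\<close>
      then show False
        using elim(1) e by (auto simp: neg_log_def)
    qed
  qed
qed

section \<open>Binary digits and the densities\<close>

text \<open>For \<open>k \<ge> 1\<close> this is \<open>(1 + r) / 2\<close> with \<open>r\<close>
  the Rademacher function of index \<open>k\<close>. The index 0, the parity of the integer part,
  serves as the base of the recursion in \<open>k\<close>. Being defined on all reals, it satisfies
  the scaling and translation rules without domain conditions.\<close>

definition even_digit :: "nat \<Rightarrow> real \<Rightarrow> real" where
  "even_digit k x = (if even \<lfloor>2 ^ k * x\<rfloor> then 1 else 0)"

lemma even_digit_measurable [measurable]: "even_digit k \<in> borel_measurable borel"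
  unfolding even_digit_def by measurable

lemma abs_even_digit_le_1: "\<bar>even_digit k x\<bar> \<le> 1"
  by (simp add: even_digit_def)

lemma abs_even_digit_mult_le_1: "\<bar>even_digit k x * even_digit l x\<bar> \<le> 1"
  by (simp add: even_digit_def)

lemma even_digit_half: "even_digit (Suc k) (x / 2) = even_digit k x"
  by (simp add: even_digit_def)

text \<open>The floor grows by \<open>2 ^ k\<close>, which is even exactly because
  \<open>k \<ge> 1\<close>; at index 0 the parity would flip.\<close>

lemma even_digit_add_1:
  assumes "k \<ge> 1"
  shows "even_digit k (1 + x) = even_digit k x"
proof -
  have "\<lfloor>2 ^ k * (1 + x)\<rfloor> = \<lfloor>2 ^ k * x + of_int (2 ^ k)\<rfloor>"
    by (simp add: algebra_simps)
  also have "\<dots> = \<lfloor>2 ^ k * x\<rfloor> + 2 ^ k"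
    by (rule floor_add_int [symmetric])
  finally show ?thesis
    using assms by (simp add: even_digit_def)
qed

lemma even_digit_0:
  assumes "x \<in> {0..<1}"
  shows "even_digit 0 x = 1" "even_digit 0 (1 + x) = 0"
proof -
  have "\<lfloor>x\<rfloor> = 0" "\<lfloor>1 + x\<rfloor> = 1"
    using assms by (auto simp: floor_eq_iff)
  then show "even_digit 0 x = 1" "even_digit 0 (1 + x) = 0"
    by (simp_all add: even_digit_def)
qed

text \<open>Scaling by \<open>2 ^ k\<close> turns the intervals of \<open>H_set k\<close> into
  \<open>[2j, 2j+1]\<close>, where the floor is even except at the right end point. The two sides
  can disagree only where \<open>2 ^ k * x\<close> is an integer.\<close>

lemma sigma_density_eq_even_digit:
  assumes "x \<in> {0..1}" "k \<ge> 1" "2 ^ k * x \<notin> \<int>"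
  shows "sigma_density k x = 2 * even_digit k x"
proof -
  obtain m where k: "k = Suc m"
    using assms(2) by (cases k) auto
  have "x \<in> H_set k \<longleftrightarrow> even \<lfloor>2 ^ k * x\<rfloor>"
  proof
    assume "x \<in> H_set k"
    then obtain j where j: "real j / 2 ^ m \<le> x" "x \<le> real j / 2 ^ m + 1 / 2 ^ Suc m"
      by (auto simp: H_set_def k)
    then have "2 * real j \<le> 2 ^ k * x" "2 ^ k * x \<le> 2 * real j + 1"
      by (simp_all add: k field_simps)
    \<comment> \<open>This rules out the right end point of the closed interval, where the floor is
      already odd.\<close>
    moreover have "2 ^ k * x \<noteq> of_int (2 * int j + 1)"
      using assms(3) Ints_of_int by metis
    ultimately have "\<lfloor>2 ^ k * x\<rfloor> = 2 * int j"
      by (simp add: floor_eq_iff)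
    then show "even \<lfloor>2 ^ k * x\<rfloor>" by simp
  next
    assume "even \<lfloor>2 ^ k * x\<rfloor>"
    then obtain i where i: "\<lfloor>2 ^ k * x\<rfloor> = 2 * i"
      by (rule evenE)
    have "\<lfloor>2 ^ k * x\<rfloor> \<ge> 0" using assms(1) by simp
    with i have "i \<ge> 0" by simp
    then obtain j where "i = int j"
      by (rule nonneg_int_cases)
    with i have "\<lfloor>2 ^ k * x\<rfloor> = 2 * int j" by simp
    then have b: "2 * real j \<le> 2 ^ k * x" "2 ^ k * x < 2 * real j + 1"
      by (simp_all add: floor_eq_iff)
    have "2 * real j < 2 * 2 ^ m"
    proof -
      have "2 ^ k * x \<le> 2 ^ k" using assms(1) by simp
      \<comment> \<open>The point \<open>x = 1\<close> must be excluded: the floor there is the even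
        number \<open>2 ^ k\<close>, but the last interval of \<open>H_set k\<close> ends before
        1.\<close>
      moreover have "2 ^ k * x \<noteq> 2 ^ k" using assms(3) by (metis Ints_numeral Ints_power)
      ultimately have "2 * real j < 2 ^ k" using b(1) by linarith
      then show ?thesis by (simp add: k)
    qed
    then have "real j < real (2 ^ m)"
      by simp
    then have "j < 2 ^ m"
      by (simp only: of_nat_less_iff)
    moreover have "real j / 2 ^ m \<le> x" "x \<le> real j / 2 ^ m + 1 / 2 ^ Suc m"
      using b by (simp_all add: k field_simps)
    ultimately show "x \<in> H_set k"
      by (auto simp: H_set_def k)
  qed
  then show ?thesis
    by (simp add: sigma_density_def even_digit_def)
qed

lemma AE_not_dyadic: "AE x in lborel. 2 ^ k * (x :: real) \<notin> \<int>"
proof -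
  have "{x :: real. 2 ^ k * x \<in> \<int>} \<subseteq> (\<lambda>m. of_int m / 2 ^ k) ` UNIV"
    by (auto elim!: Ints_cases simp: field_simps image_iff)
  then have "countable {x :: real. 2 ^ k * x \<in> \<int>}"
    by (rule countable_subset) auto
  then show ?thesis
    by (intro AE_I'[OF countable_imp_null_set_lborel]) auto
qed

lemma H_set_borel [measurable]: "H_set k \<in> sets borel"
  unfolding H_set_def by measurable

lemma sigma_density_measurable [measurable]: "sigma_density k \<in> borel_measurable borel"
  unfolding sigma_density_def by measurable

section \<open>Integrals of binary digits by self-similarity\<close>

text \<open>Each half of the interval is rescaled to full length by an affine substitution with
  factor 1/2. Combined with \<open>even_digit_half\<close>, this lowers the index of a digit by one.
  Half-open intervals make the halves disjoint, and the bound on \<open>f\<close> gives the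
  integrability needed for splitting.\<close>

lemma integral_halves:
  fixes f :: "real \<Rightarrow> real"
  assumes [measurable]: "f \<in> borel_measurable borel" and f_bdd: "\<And>x. \<bar>f x\<bar> \<le> B"
  shows "(\<integral>x. indicator {0..<1} x * f x \<partial>lborel) =
         ((\<integral>x. indicator {0..<1} x * f (x / 2) \<partial>lborel) +
          (\<integral>x. indicator {0..<1} x * f ((1 + x) / 2) \<partial>lborel)) / 2"
proof -
  have int: "integrable lborel (\<lambda>x. indicator A x * f x)"
    if [measurable]: "A \<in> sets borel" and "A \<subseteq> {0..1}" for A
  proof (rule Bochner_Integration.integrable_bound)
    have "emeasure lborel A < \<infinity>"
      using that(2) by (intro emeasure_bounded_finite bounded_subset[OF bounded_closed_interval])
    then show "integrable lborel (\<lambda>x. indicator A x * B)"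
      by simp
  qed (use f_bdd in \<open>auto simp: indicator_def intro: order_trans abs_ge_self\<close>)
  have "(\<integral>x. indicator {0..<1} x * f x \<partial>lborel) =
        (\<integral>x. indicator {0..<1/2} x * f x + indicator {1/2..<1} x * f x \<partial>lborel)"
    by (intro Bochner_Integration.integral_cong) (auto simp: indicator_def)
  also have "\<dots> = (\<integral>x. indicator {0..<1/2} x * f x \<partial>lborel)
                + (\<integral>x. indicator {1/2..<1} x * f x \<partial>lborel)"
    by (intro Bochner_Integration.integral_add int) auto
  also have "(\<integral>x. indicator {0..<1/2} x * f x \<partial>lborel) =
             (\<integral>x. indicator {0..<1} x * f (x / 2) \<partial>lborel) / 2"
    by (subst lborel_integral_real_affine[where c = "1/2" and t = 0])
       (auto simp: indicator_def intro!: Bochner_Integration.integral_cong)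
  also have "(\<integral>x. indicator {1/2..<1} x * f x \<partial>lborel) =
             (\<integral>x. indicator {0..<1} x * f ((1 + x) / 2) \<partial>lborel) / 2"
    by (subst lborel_integral_real_affine[where c = "1/2" and t = "1/2"])
       (auto simp: indicator_def add_divide_distrib intro!: Bochner_Integration.integral_cong)
  finally show ?thesis by simp
qed

lemma integral_even_digit:
  assumes "k \<ge> 1"
  shows "(\<integral>x. indicator {0..<1} x * even_digit k x \<partial>lborel) = 1 / 2"
  using assms
proof (induction k rule: dec_induct)
  case base
  \<comment> \<open>Halving turns digit 1 into digit 0, which is constantly 1 on the left half and 0
    on the right half.\<close>
  have "(\<integral>x. indicator {0..<1} x * even_digit 0 x \<partial>lborel) =
        (\<integral>x. indicator {0..<1::real} x \<partial>lborel)"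
    by (intro Bochner_Integration.integral_cong) (auto simp: indicator_def even_digit_0)
  moreover have "(\<integral>x. indicator {0..<1} x * even_digit 0 (1 + x) \<partial>lborel) = 0"
    by (rule integral_eq_zero_AE) (auto simp: indicator_def even_digit_0)
  ultimately show ?case
    by (subst integral_halves[where B = 1])
       (simp_all add: abs_even_digit_le_1 even_digit_half)
next
  case (step k)
  then show ?case
    by (subst integral_halves[where B = 1])
       (simp_all add: abs_even_digit_le_1 even_digit_half even_digit_add_1)
qed

text \<open>Different digits are independent. Halving lowers both indices together until the smaller
  one is 1; one more halving keeps only the left half, where the integral of the remaining digit is
  1/2.\<close>

lemma integral_even_digit_mult:
  assumes "k \<ge> 1" "k < l"
  shows "(\<integral>x. indicator {0..<1} x * (even_digit k x * even_digit l x) \<partial>lborel) = 1 / 4"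
  using assms
proof (induction k arbitrary: l rule: dec_induct)
  case base
  then obtain m where l: "l = Suc m" "m \<ge> 1"
    by (cases l) auto
  have "(\<integral>x. indicator {0..<1} x * (even_digit 0 x * even_digit m x) \<partial>lborel) =
        (\<integral>x. indicator {0..<1} x * even_digit m x \<partial>lborel)"
    by (intro Bochner_Integration.integral_cong) (auto simp: indicator_def even_digit_0)
  moreover have "(\<integral>x. indicator {0..<1} x * (even_digit 0 (1 + x) * even_digit m (1 + x)) \<partial>lborel) = 0"
    by (rule integral_eq_zero_AE) (auto simp: indicator_def even_digit_0)
  ultimately show ?case
    by (subst integral_halves[where B = 1])
       (simp_all add: abs_even_digit_mult_le_1 l(1) even_digit_half integral_even_digit[OF l(2)])
next
  case (step k)
  then obtain m where l: "l = Suc m" "k < m"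
    by (cases l) auto
  then show ?case
    using step
    by (subst integral_halves[where B = 1])
       (simp_all add: abs_even_digit_mult_le_1 even_digit_half even_digit_add_1)
qed

section \<open>First and second moments on the unit interval\<close>

lemma prob_space_unit_interval: "prob_space unit_interval"
  unfolding unit_interval_def
  by (rule prob_spaceI) (simp add: emeasure_restrict_space space_restrict_space)

lemma space_unit_interval [simp]: "space unit_interval = {0..1}"
  by (simp add: unit_interval_def space_restrict_space)

lemma borel_measurable_unit_interval [measurable (raw)]:
  "f \<in> borel_measurable borel \<Longrightarrow> f \<in> borel_measurable unit_interval"
  unfolding unit_interval_def by (rule measurable_restrict_space1) simp

text \<open>Passes to the half-open interval of the halving recursion and replaces densities by
  digits at once; the end point 1 and the exceptional points form a null set.\<close>

lemma integral_unit_interval: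
  fixes f g :: "real \<Rightarrow> real"
  assumes [measurable]: "f \<in> borel_measurable borel" "g \<in> borel_measurable borel"
    and eq: "AE x in lborel. x \<in> {0..1} \<longrightarrow> f x = g x"
  shows "(\<integral>x. f x \<partial>unit_interval) = (\<integral>x. indicator {0..<1} x * g x \<partial>lborel)"
proof -
  have "(\<integral>x. f x \<partial>unit_interval) = (\<integral>x. indicator {0..1} x * f x \<partial>lborel)"
    unfolding unit_interval_def by (subst integral_restrict_space) auto
  also have "\<dots> = (\<integral>x. indicator {0..<1} x * g x \<partial>lborel)"
  proof (rule integral_cong_AE)
    have "AE x in lborel. x \<noteq> (1::real)"
      by (rule AE_lborel_singleton)
    with eq show "AE x in lborel. indicator {0..1} x * f x = indicator {0..<1} x * g x"
      by eventually_elim (auto simp: indicator_def)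
  qed auto
  finally show ?thesis .
qed

lemma AE_sigma_density:
  assumes "k \<ge> 1"
  shows "AE x in lborel. x \<in> {0..1} \<longrightarrow> sigma_density k x = 2 * even_digit k x"
  using AE_not_dyadic[of k] by eventually_elim (use assms sigma_density_eq_even_digit in blast)

lemma integral_sigma_density:
  assumes "k \<ge> 1"
  shows "(\<integral>x. sigma_density k x \<partial>unit_interval) = 1"
proof -
  have "(\<integral>x. sigma_density k x \<partial>unit_interval) =
        (\<integral>x. indicator {0..<1} x * (2 * even_digit k x) \<partial>lborel)"
    using assms by (intro integral_unit_interval AE_sigma_density) auto
  also have "\<dots> = 2 * (\<integral>x. indicator {0..<1} x * even_digit k x \<partial>lborel)"
    by (simp add: mult.left_commute flip: integral_mult_right_zero)
  finally show ?thesis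
    using assms by (simp add: integral_even_digit)
qed

text \<open>The density takes only the values 0 and 2, so its square is twice itself.\<close>

lemma integral_sigma_density_sq:
  assumes "k \<ge> 1"
  shows "(\<integral>x. sigma_density k x * sigma_density k x \<partial>unit_interval) = 2"
proof -
  have "(\<integral>x. sigma_density k x * sigma_density k x \<partial>unit_interval) =
        (\<integral>x. 2 * sigma_density k x \<partial>unit_interval)"
    by (intro Bochner_Integration.integral_cong) (auto simp: sigma_density_def indicator_def)
  then show ?thesis
    using assms by (simp add: integral_sigma_density)
qed

text \<open>By symmetry \<open>k < l\<close> may be assumed; independence of the digits then gives
  \<open>4 * (1 / 4)\<close>.\<close>

lemma integral_sigma_density_mult:
  assumes "k \<ge> 1" "l \<ge> 1" "k \<noteq> l"
  shows "(\<integral>x. sigma_density k x * sigma_density l x \<partial>unit_interval) = 1"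
proof -
  have *: "(\<integral>x. sigma_density k x * sigma_density l x \<partial>unit_interval) = 1"
    if "k \<ge> 1" "k < l" for k l
  proof -
    have "(\<integral>x. sigma_density k x * sigma_density l x \<partial>unit_interval) =
          (\<integral>x. indicator {0..<1} x * (4 * (even_digit k x * even_digit l x)) \<partial>lborel)"
    proof (rule integral_unit_interval)
      have "l \<ge> 1" using that by simp
      show "AE x in lborel. x \<in> {0..1} \<longrightarrow>
              sigma_density k x * sigma_density l x = 4 * (even_digit k x * even_digit l x)"
        using AE_sigma_density[OF \<open>k \<ge> 1\<close>] AE_sigma_density[OF \<open>l \<ge> 1\<close>]
        by eventually_elim simp
    qed measurable
    also have "\<dots> = 4 * (\<integral>x. indicator {0..<1} x * (even_digit k x * even_digit l x) \<partial>lborel)"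
      by (simp add: mult.left_commute flip: integral_mult_right_zero)
    finally show ?thesis
      using that by (simp add: integral_even_digit_mult)
  qed
  show ?thesis
  proof (cases "k < l")
    case False
    then show ?thesis using *[of l k] assms by (simp add: mult.commute)
  qed (use * assms in simp)
qed

section \<open>Tensor powers on the cube\<close>

lemma prob_space_unit_cube: "prob_space (unit_cube n)"
  unfolding unit_cube_def by (intro prob_space_PiM prob_space_unit_interval)

lemma tensor_density_measurable [measurable]:
  assumes [measurable]: "\<omega> \<in> borel_measurable borel"
  shows "tensor_density \<omega> n \<in> borel_measurable (unit_cube n)"
  unfolding tensor_density_def unit_cube_def
proof (intro borel_measurable_prod)
  fix i assume "i \<in> {..<n}"
  then show "(\<lambda>x. \<omega> (x i)) \<in> borel_measurable (Pi\<^sub>M {..<n} (\<lambda>_. unit_interval))"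
    by (intro measurable_compose[OF measurable_component_singleton]) auto
qed

lemma integral_tensor_density:
  assumes [measurable]: "\<omega> \<in> borel_measurable borel" and "\<And>x. \<bar>\<omega> x\<bar> \<le> B"
  shows "(\<integral>x. tensor_density \<omega> n x \<partial>unit_cube n) = (\<integral>x. \<omega> x \<partial>unit_interval) ^ n"
proof -
  interpret prob_space unit_interval by (rule prob_space_unit_interval)
  interpret product_sigma_finite "\<lambda>_::nat. unit_interval" ..
  have "integrable unit_interval \<omega>"
    using assms by (intro integrable_const_bound[of _ B]) auto
  then show ?thesis
    unfolding tensor_density_def unit_cube_def
    by (subst product_integral_prod) auto
qed

text \<open>Reduces inner products on the cube to powers of inner products on the interval.\<close>

lemma tensor_density_mult:
  "tensor_density \<omega> n x * tensor_density \<omega>' n x = tensor_density (\<lambda>y. \<omega> y * \<omega>' y) n x"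
  by (simp add: tensor_density_def prod.distrib)

lemma sigma_density_bounds: "0 \<le> sigma_density k x" "sigma_density k x \<le> 2"
  by (auto simp: sigma_density_def indicator_def)

lemma tensor_sigma_density_bounds:
  "0 \<le> tensor_density (sigma_density k) n x" "tensor_density (sigma_density k) n x \<le> 2 ^ n"
proof -
  show "0 \<le> tensor_density (sigma_density k) n x"
    unfolding tensor_density_def by (intro prod_nonneg ballI sigma_density_bounds)
  have "tensor_density (sigma_density k) n x \<le> (\<Prod>i<n. 2)"
    unfolding tensor_density_def by (intro prod_mono conjI sigma_density_bounds)
  then show "tensor_density (sigma_density k) n x \<le> 2 ^ n"
    by simp
qed

lemma integral_tensor_sigma_density:
  assumes "k \<ge> 1"
  shows "(\<integral>x. tensor_density (sigma_density k) n x \<partial>unit_cube n) = 1"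
  using assms
  by (subst integral_tensor_density[where B = 2])
     (simp_all add: abs_of_nonneg sigma_density_bounds integral_sigma_density)

text \<open>Each coordinate contributes a factor 2 or 1. After subtracting 1 from the densities, the
  system is orthogonal with squared norm \<open>2 ^ n - 1\<close>.\<close>

lemma integral_tensor_sigma_density_mult:
  assumes "k \<ge> 1" "l \<ge> 1"
  shows "(\<integral>x. tensor_density (sigma_density k) n x * tensor_density (sigma_density l) n x
            \<partial>unit_cube n) = (if k = l then 2 ^ n else 1)"
proof -
  have "\<bar>sigma_density k y * sigma_density l y\<bar> \<le> 4" for y
    by (auto simp: sigma_density_def indicator_def)
  then show ?thesis
    using assms unfolding tensor_density_mult
    by (subst integral_tensor_density[where B = 4])
       (auto simp: integral_sigma_density_sq integral_sigma_density_mult)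
qed

lemma tensor_uniform_density:
  assumes "x \<in> space (unit_cube n)"
  shows "tensor_density uniform_density n x = 1"
proof -
  have "x i \<in> {0..1}" if "i < n" for i
    using assms that by (auto simp: unit_cube_def space_PiM PiE_iff)
  then show ?thesis
    unfolding tensor_density_def uniform_density_def by (intro prod.neutral) simp
qed

section \<open>Errors of a single test\<close>

lemma integrable_test:
  assumes "is_test n T"
  shows "integrable (unit_cube n) T"
proof -
  interpret prob_space "unit_cube n" by (rule prob_space_unit_cube)
  show ?thesis
    using assms by (intro integrable_const_bound[of _ 1]) (auto simp: is_test_def)
qed

lemma type1_error_uniform:
  assumes "is_test n T"
  shows "type1_error uniform_density n T = 1 - (\<integral>x. T x \<partial>unit_cube n)"
proof -
  interpret prob_space "unit_cube n" by (rule prob_space_unit_cube)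
  have "type1_error uniform_density n T = (\<integral>x. 1 - T x \<partial>unit_cube n)"
    unfolding type1_error_def expect_test_def
    by (intro Bochner_Integration.integral_cong) (auto simp: tensor_uniform_density)
  then show ?thesis
    using integrable_test[OF assms] by (simp add: prob_space)
qed

lemma integrable_tensor_sigma_test:
  assumes "is_test n T"
  shows "integrable (unit_cube n) (\<lambda>x. tensor_density (sigma_density k) n x * T x)"
proof -
  interpret prob_space "unit_cube n" by (rule prob_space_unit_cube)
  have [measurable]: "T \<in> borel_measurable (unit_cube n)"
    using assms by (simp add: is_test_def)
  show ?thesis
    using assms tensor_sigma_density_bounds
    by (intro integrable_const_bound[of _ "2 ^ n * 1"])
       (auto simp: is_test_def abs_mult simp del: mult_1_right intro!: mult_mono)
qed

lemma integrable_tensor_sigma: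
  "integrable (unit_cube n) (tensor_density (sigma_density k) n)"
  using integrable_tensor_sigma_test[of n "\<lambda>_. 1" k] by (simp add: is_test_def)

text \<open>A real supremum dominates its members only if they are bounded above; here 1 is a bound,
  as \<open>T\<close> is at most 1 and the densities integrate to 1.\<close>

lemma expect_test_le_type2_error:
  assumes "is_test n T" "k \<ge> 1"
  shows "expect_test (sigma_density k) n T \<le> type2_error sigma_family n T"
  unfolding type2_error_def
proof (rule cSUP_upper)
  show "sigma_density k \<in> sigma_family"
    using assms(2) by (auto simp: sigma_family_def)
  show "bdd_above ((\<lambda>\<sigma>. expect_test \<sigma> n T) ` sigma_family)"
  proof (rule bdd_aboveI2)
    fix \<sigma> assume "\<sigma> \<in> sigma_family"
    then obtain k where k: "\<sigma> = sigma_density k" "k \<ge> 1"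
      by (auto simp: sigma_family_def)
    have "expect_test \<sigma> n T \<le> (\<integral>x. tensor_density (sigma_density k) n x \<partial>unit_cube n)"
      unfolding expect_test_def k
      using assms(1) tensor_sigma_density_bounds
      by (intro integral_mono integrable_tensor_sigma_test integrable_tensor_sigma mult_left_le)
         (auto simp: is_test_def)
    then show "expect_test \<sigma> n T \<le> 1"
      using k by (simp add: integral_tensor_sigma_density)
  qed
qed

text \<open>For fixed \<open>n\<close>, some density in the family gives \<open>T\<close> an
  expectation above its uniform expectation minus \<open>\<epsilon>\<close>, by
  \<open>orthogonal_correlation_lower_bound\<close>.\<close>

lemma type1_error_plus_type2_error:
  assumes T: "is_test n T"
  shows "type1_error uniform_density n T + type2_error sigma_family n T \<ge> 1"
proof (rule field_le_epsilon)
  fix \<epsilon> :: real assume "\<epsilon> > 0"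
  interpret prob_space "unit_cube n" by (rule prob_space_unit_cube)
  \<comment> \<open>The shift matches the family, indexed from 1, with a sequence indexed from
    0.\<close>
  define f where "f k = tensor_density (sigma_density (Suc k)) n" for k
  have [measurable]: "T \<in> borel_measurable (unit_cube n)"
    and T_bdd: "\<And>x. x \<in> space (unit_cube n) \<Longrightarrow> \<bar>T x\<bar> \<le> 1"
    using T by (auto simp: is_test_def)
  have f_meas [measurable]: "f k \<in> borel_measurable (unit_cube n)" for k
    by (simp add: f_def)
  have f_bdd: "0 \<le> f k x" "f k x \<le> 2 ^ n" for k x
    by (simp_all add: f_def tensor_sigma_density_bounds)
  have f_int [simp]: "integrable (unit_cube n) (f k)" for k
    by (simp add: f_def integrable_tensor_sigma)
  have ff_int [simp]: "integrable (unit_cube n) (\<lambda>x. f k x * f l x)" for k l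
    using f_bdd by (intro integrable_const_bound[of _ "2 ^ n * 2 ^ n"]) (auto simp: abs_mult intro!: mult_mono)
  have cov: "(\<integral>x. (f k x - 1) * (f l x - 1) \<partial>unit_cube n) = (if k = l then 2 ^ n - 1 else 0)" for k l
  proof -
    have "(\<integral>x. (f k x - 1) * (f l x - 1) \<partial>unit_cube n) =
          (\<integral>x. f k x * f l x - f k x - f l x + 1 \<partial>unit_cube n)"
      by (simp add: algebra_simps)
    also have "\<dots> = (\<integral>x. f k x * f l x \<partial>unit_cube n) - 1"
      by (simp add: f_def integrable_tensor_sigma integral_tensor_sigma_density prob_space
          ff_int[unfolded f_def])
    finally show ?thesis
      by (simp add: f_def integral_tensor_sigma_density_mult)
  qed
  have "\<exists>k. (\<integral>x. (f k x - 1) * T x \<partial>unit_cube n) > - \<epsilon>"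
  proof (rule orthogonal_correlation_lower_bound[where B = "2 ^ n + 1" and D = "2 ^ n - 1"])
    show "\<bar>f k x - 1\<bar> \<le> 2 ^ n + 1" for k x
      using f_bdd[of k x] by linarith
  qed (use T_bdd \<open>\<epsilon> > 0\<close> in \<open>auto simp: cov\<close>)
  then obtain k where "(\<integral>x. (f k x - 1) * T x \<partial>unit_cube n) > - \<epsilon>" ..
  also have "(\<integral>x. (f k x - 1) * T x \<partial>unit_cube n) =
             expect_test (sigma_density (Suc k)) n T - (\<integral>x. T x \<partial>unit_cube n)"
    using integrable_tensor_sigma_test[OF T] integrable_test[OF T]
    by (simp add: f_def expect_test_def left_diff_distrib)
  finally have "(\<integral>x. T x \<partial>unit_cube n) - \<epsilon> < type2_error sigma_family n T"
    using expect_test_le_type2_error[OF T, of "Suc k"] by simp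
  then show "1 \<le> type1_error uniform_density n T + type2_error sigma_family n T + \<epsilon>"
    by (simp add: type1_error_uniform[OF T])
qed

section \<open>Vanishing of the three exponents\<close>

lemma not_both_eventually_less_half:
  assumes "test_sequence T"
    and "\<forall>\<^sub>F n in sequentially. type1_error uniform_density n (T n) < 1 / 2"
    and "\<forall>\<^sub>F n in sequentially. type2_error sigma_family n (T n) < 1 / 2"
  shows False
proof -
  have "\<forall>\<^sub>F n in sequentially. False"
    \<comment> \<open>Index 0 is discarded because \<open>test_sequence\<close> does not constrain
      \<open>T 0\<close>.\<close>
    using assms(2,3) eventually_ge_at_top[of 1]
  proof eventually_elim
    case (elim n)
    then show ?case
      using type1_error_plus_type2_error[of n "T n"] assms(1) by (simp add: test_sequence_def)
  qed
  then show False by simp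
qed

lemma sigma_family_nonempty: "sigma_family \<noteq> {}"
  by (auto simp: sigma_family_def)

text \<open>Constant tests show that the value 0 is attained in each supremum: \<open>c = 1\<close>
  for Stein, \<open>c = 0\<close> for Chernoff and direct.\<close>

lemma errors_of_const_test:
  assumes "c \<in> {0..1}"
  shows "is_test n (\<lambda>_. c)"
    and "type1_error uniform_density n (\<lambda>_. c) = 1 - c"
    and "type2_error sigma_family n (\<lambda>_. c) = c"
proof -
  interpret prob_space "unit_cube n" by (rule prob_space_unit_cube)
  show test: "is_test n (\<lambda>_. c)"
    using assms by (simp add: is_test_def)
  show "type1_error uniform_density n (\<lambda>_. c) = 1 - c"
    by (simp add: type1_error_uniform[OF test] prob_space)
  have "expect_test \<sigma> n (\<lambda>_. c) = c" if "\<sigma> \<in> sigma_family" for \<sigma>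
    using that by (auto simp: sigma_family_def expect_test_def integral_tensor_sigma_density)
  then show "type2_error sigma_family n (\<lambda>_. c) = c"
    using sigma_family_nonempty by (simp add: type2_error_def)
qed

lemma error_rate_1: "error_rate (\<lambda>n. 1) = 0"
  by (simp add: error_rate_def neg_log_def Liminf_const flip: zero_ereal_def)

lemma error_rate_0: "error_rate (\<lambda>n. 0) = \<infinity>"
proof -
  have "error_rate (\<lambda>n. 0) = liminf (\<lambda>n. \<infinity> :: ereal)"
    unfolding error_rate_def
    \<comment> \<open>At \<open>n = 0\<close> the term is \<open>0 * \<infinity> = 0\<close>, so the
      two sequences agree only from 1 on.\<close>
    by (intro Liminf_eq eventually_mono[OF eventually_gt_at_top[of 0]]) (simp add: neg_log_def)
  then show ?thesis by (simp add: Liminf_const)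
qed

theorem mainTheorem4:
  shows "stein_exponent uniform_density sigma_family = 0 \<and>
         chernoff_exponent uniform_density sigma_family = 0 \<and>
         (\<forall>r::real. r > 0 \<longrightarrow> direct_exponent r uniform_density sigma_family = 0)"
proof (intro conjI allI impI)
  let ?\<alpha> = "\<lambda>T n. type1_error uniform_density n (T n)"
  let ?\<beta> = "\<lambda>T n. type2_error sigma_family n (T n)"
  have const: "test_sequence (\<lambda>_ _. c)" "?\<alpha> (\<lambda>_ _. c) = (\<lambda>_. 1 - c)" "?\<beta> (\<lambda>_ _. c) = (\<lambda>_. c)"
    if "c \<in> {0..1}" for c
    using errors_of_const_test[OF that] by (simp_all add: test_sequence_def)
  have rates_not_both_pos: "error_rate (?\<beta> T) \<le> 0 \<or> error_rate (?\<alpha> T) \<le> 0"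
    if "test_sequence T" for T
    using not_both_eventually_less_half[OF that] eventually_less_half_of_error_rate_pos
    by (meson not_le)

  show "stein_exponent uniform_density sigma_family = 0"
    unfolding stein_exponent_def
  proof (intro antisym Sup_least Sup_upper; clarify?)
    fix T assume "test_sequence T" "?\<alpha> T \<longlonglongrightarrow> 0"
    \<comment> \<open>Here convergence to 0 takes the place of a positive rate for the first
      error.\<close>
    moreover from this(2) have "\<forall>\<^sub>F n in sequentially. ?\<alpha> T n < 1 / 2"
      by (rule order_tendstoD) simp
    ultimately show "error_rate (?\<beta> T) \<le> 0"
      using not_both_eventually_less_half eventually_less_half_of_error_rate_pos by (meson not_le)
  next
    show "\<exists>T. 0 = error_rate (?\<beta> T) \<and> test_sequence T \<and> ?\<alpha> T \<longlonglongrightarrow> 0"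
      by (rule exI[of _ "\<lambda>_ _. 1"]) (simp add: const error_rate_1)
  qed

  show "chernoff_exponent uniform_density sigma_family = 0"
    unfolding chernoff_exponent_def
  proof (intro antisym Sup_least Sup_upper; clarify?)
    fix r T
    assume "test_sequence T" "ereal r \<le> error_rate (?\<alpha> T)" "ereal r \<le> error_rate (?\<beta> T)"
    then show "ereal r \<le> 0"
      using rates_not_both_pos order_trans by blast
  next
    show "\<exists>r. 0 = ereal r \<and> 0 \<le> r \<and> (\<exists>T. test_sequence T \<and>
            ereal r \<le> error_rate (?\<alpha> T) \<and> ereal r \<le> error_rate (?\<beta> T))"
      \<comment> \<open>The zero test has first error 1 and second error 0, hence rates 0 and
        \<infinity>.\<close>
      by (rule exI[of _ 0], simp, rule exI[of _ "\<lambda>_ _. 0"])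
         (simp add: const error_rate_0 error_rate_1)
  qed

  fix r :: real
  assume r: "r > 0"
  show "direct_exponent r uniform_density sigma_family = 0"
    unfolding direct_exponent_def
  proof (intro antisym Sup_least Sup_upper; clarify?)
    fix T assume T: "test_sequence T" "ereal r \<le> error_rate (?\<beta> T)"
    then have "0 < error_rate (?\<beta> T)"
      using r by (intro less_le_trans[OF _ T(2)]) simp
    then show "error_rate (?\<alpha> T) \<le> 0"
      using rates_not_both_pos[OF T(1)] by (meson not_le)
  next
    show "\<exists>T. 0 = error_rate (?\<alpha> T) \<and> test_sequence T \<and> ereal r \<le> error_rate (?\<beta> T)"
      \<comment> \<open>The infinite rate of the second error makes the zero test admissible for
        every \<open>r\<close>.\<close>
      by (rule exI[of _ "\<lambda>_ _. 0"]) (simp add: const error_rate_0 error_rate_1)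
  qed
qed

end
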